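(* Let $X_r$ be the Bott tower determined by integers $\beta_{ij}$ ($1\le i<j\le r$). The set $\{r(P_i):1\le i\le r\}$ forms a basis of $N_1(X_r)_{\mathbb Z}$.
   Context: Work over $\mathbb C$. The Bott tower $X_r$ determined by integers $\beta_{ij}$, $1\le i<j\le r$ (an iterated $\mathbb P^1$-bundle $X_i=\mathbb P(\mathcal O_{X_{i-1}}\oplus\mathcal L_{i-1})$ over a point), is the smooth projective toric variety of the fan $\Sigma$ in $\mathbb R^r$ whose maximal cones are the $2^r$ cones generated by $\{e_1^{\epsilon_1},\dots,e_r^{\epsilon_r}\}$, $(\epsilon_1,\dots,\epsilon_r)\in\{+,-\}^r$, where $e_1^+,\dots,e_r^+$ is the standard basis of $\mathbb Z^r$ and $e_i^-:=-e_i^+-\sum_{j>i}\beta_{ij}e_j^+$. $\Sigma(1)$ is the set of rays of $\Sigma$; $\rho_i^{\epsilon}$ is the ray generated by $e_i^\epsilon$; $u_\rho$ is the primitive generator of $\rho$; $D_\rho$ is the torus-invariant prime divisor of $\rho$. $N_1(X_r)_{\mathbb Z}$ is the group of integral $1$-cycles modulo numerical equivalence. The map $[C]\mapsto(D_\rho\cdot C)_{\rho\in\Sigma(1)}$ identifies $N_1(X_r)_{\mathbb Z}$ with $\{(r_\rho)\in\mathbb Z^{\Sigma(1)}:\sum_\rho r_\rho u_\rho=0\}$. For $1\le i\le r$ let $P_i=\{\rho_i^+,\rho_i^-\}$, let $\gamma_{P_i}$ be the unique cone of $\Sigma$ containing $e_i^++e_i^-$ in its relative interior, $\gamma_{P_i}(1)$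 the set of its rays, and write $e_i^++e_i^-=\sum_{\rho\in\gamma_{P_i}(1)}c^{(i)}_\rho u_\rho$ with $c^{(i)}_\rho\in\mathbb Z_{>0}$. Then $r(P_i)\in N_1(X_r)_{\mathbb Z}$ is the class corresponding to $(r_\rho)_\rho$ with $r_\rho=1$ for $\rho\in P_i$, $r_\rho=-c^{(i)}_\rho$ for $\rho\in\gamma_{P_i}(1)$, and $r_\rho=0$ otherwise. *)

theory Defs
  imports "HOL-Analysis.Analysis" "HOL-Library.Function_Algebras"
begin

section \<open>Integer-valued functions as a module over the integers\<close>

definition int_scale :: "int \<Rightarrow> ('a \<Rightarrow> int) \<Rightarrow> 'a \<Rightarrow> int" where
  "int_scale k f = (\<lambda>x. k * f x)"

interpretation zmod: module "int_scale :: int \<Rightarrow> ('a \<Rightarrow> int) \<Rightarrow> 'a \<Rightarrow> int"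
  by unfold_locales (auto simp: int_scale_def fun_eq_iff algebra_simps)

definition is_Z_basis :: "('a \<Rightarrow> int) set \<Rightarrow> ('a \<Rightarrow> int) set \<Rightarrow> bool" where
  "is_Z_basis B N \<longleftrightarrow> zmod.independent B \<and> zmod.span B = N"


section \<open>Fans in $\mathbb R^n$ with lattice $\mathbb Z^n$\<close>

text \<open>A fan is given by its set of cones.\<close>

definition lattice_points :: "(real ^ 'n) set" where
  "lattice_points = {x. \<forall>k. x $ k \<in> \<int>}"

definition rays :: "(real ^ 'n) set set \<Rightarrow> (real ^ 'n) set set" where
  "rays \<Sigma> = {\<rho> \<in> \<Sigma>. dim \<rho> = 1}"

definition cone_rays :: "(real ^ 'n) set set \<Rightarrow> (real ^ 'n) set \<Rightarrow> (real ^ 'n) set set" where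
  "cone_rays \<Sigma> \<gamma> = {\<rho> \<in> rays \<Sigma>. \<rho> face_of \<gamma>}"

text \<open>The primitive generator \<open>u\<^sub>\<rho>\<close> of a ray is the generator of the monoid of its lattice points.\<close>

definition prim_gen :: "(real ^ 'n) set \<Rightarrow> real ^ 'n" where
  "prim_gen \<rho> = (THE u. \<rho> \<inter> lattice_points = {real m *\<^sub>R u | m :: nat. True})"

text \<open>
  The group of integral 1-cycles modulo numerical equivalence on the smooth complete toric
  variety of \<open>\<Sigma>\<close>. A class \<open>[C]\<close> is represented by its intersection numbers
  \<open>\<rho> \<mapsto> D\<^sub>\<rho> \<cdot> C\<close> with the torus-invariant prime divisors, which identifies the group with
  the group of integral relations among the primitive generators. Functions on
  \<open>\<Sigma>(1)\<close> are extended by zero.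
\<close>

definition N1 :: "(real ^ 'n) set set \<Rightarrow> ((real ^ 'n) set \<Rightarrow> int) set" where
  "N1 \<Sigma> = {a. (\<forall>\<rho>. \<rho> \<notin> rays \<Sigma> \<longrightarrow> a \<rho> = 0) \<and>
              (\<Sum>\<rho>\<in>rays \<Sigma>. of_int (a \<rho>) *\<^sub>R prim_gen \<rho>) = 0}"

lemma subspace_N1: "zmod.subspace (N1 \<Sigma>)"
  by (auto simp: zmod.subspace_def N1_def int_scale_def scaleR_left_distrib sum.distrib
      simp flip: scaleR_scaleR scaleR_sum_right)


section \<open>The fan of a Bott tower\<close>

text \<open>
  The finite linearly ordered type \<open>'n\<close> plays the role of \<open>{1, \<dots>, r}\<close>; only the values
  \<open>\<beta> i j\<close> with \<open>i < j\<close> are used. The Boolean \<open>True\<close> stands for the sign \<open>+\<close>.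
\<close>

definition bott_gen :: "('n::{finite,linorder} \<Rightarrow> 'n \<Rightarrow> int) \<Rightarrow> 'n \<Rightarrow> bool \<Rightarrow> (real, 'n) vec" where
  "bott_gen \<beta> i s =
     (if s then axis i 1 else - axis i 1 - (\<Sum>j\<in>{i<..}. of_int (\<beta> i j) *\<^sub>R axis j 1))"

definition bott_ray :: "('n::{finite,linorder} \<Rightarrow> 'n \<Rightarrow> int) \<Rightarrow> 'n \<Rightarrow> bool \<Rightarrow> (real, 'n) vec set" where
  "bott_ray \<beta> i s = convex_cone hull {bott_gen \<beta> i s}"

definition bott_max_cone ::
    "('n::{finite,linorder} \<Rightarrow> 'n \<Rightarrow> int) \<Rightarrow> ('n \<Rightarrow> bool) \<Rightarrow> (real, 'n) vec set" where
  "bott_max_cone \<beta> \<epsilon> = convex_cone hull (range (\<lambda>i. bott_gen \<beta> i (\<epsilon> i)))"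

text \<open>The library regards the empty set as a face of every convex set; it is not a cone of the fan.\<close>

definition bott_fan :: "('n::{finite,linorder} \<Rightarrow> 'n \<Rightarrow> int) \<Rightarrow> (real, 'n) vec set set" where
  "bott_fan \<beta> = {\<tau>. \<tau> \<noteq> {} \<and> (\<exists>\<epsilon>. \<tau> face_of bott_max_cone \<beta> \<epsilon>)}"


section \<open>The primitive relations\<close>

definition bott_P :: "('n::{finite,linorder} \<Rightarrow> 'n \<Rightarrow> int) \<Rightarrow> 'n \<Rightarrow> (real, 'n) vec set set" where
  "bott_P \<beta> i = {bott_ray \<beta> i True, bott_ray \<beta> i False}"

definition bott_gamma :: "('n::{finite,linorder} \<Rightarrow> 'n \<Rightarrow> int) \<Rightarrow> 'n \<Rightarrow> (real, 'n) vec set" where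
  "bott_gamma \<beta> i =
     (THE \<gamma>. \<gamma> \<in> bott_fan \<beta> \<and> bott_gen \<beta> i True + bott_gen \<beta> i False \<in> rel_interior \<gamma>)"

definition bott_coeff ::
    "('n::{finite,linorder} \<Rightarrow> 'n \<Rightarrow> int) \<Rightarrow> 'n \<Rightarrow> (real, 'n) vec set \<Rightarrow> int" where
  "bott_coeff \<beta> i =
     (let G = cone_rays (bott_fan \<beta>) (bott_gamma \<beta> i) in
      THE c. (\<forall>\<rho>\<in>G. c \<rho> > 0) \<and> (\<forall>\<rho>. \<rho> \<notin> G \<longrightarrow> c \<rho> = 0) \<and>
             bott_gen \<beta> i True + bott_gen \<beta> i False = (\<Sum>\<rho>\<in>G. of_int (c \<rho>) *\<^sub>R prim_gen \<rho>))"

definition bott_rel ::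
    "('n::{finite,linorder} \<Rightarrow> 'n \<Rightarrow> int) \<Rightarrow> 'n \<Rightarrow> (real, 'n) vec set \<Rightarrow> int" where
  "bott_rel \<beta> i \<rho> =
     (if \<rho> \<in> bott_P \<beta> i then 1
      else if \<rho> \<in> cone_rays (bott_fan \<beta>) (bott_gamma \<beta> i) then - bott_coeff \<beta> i \<rho>
      else 0)"

end

theory Submission
  imports Defs
begin

text \<open>
  The vector \<open>e\<^sub>i\<^sup>+ + e\<^sub>i\<^sup>-\<close> involves only the basis vectors with index above \<open>i\<close>, so its carrier cone
  \<open>\<gamma>\<close> only has rays of index above \<open>i\<close>. Hence the matrix of values of the \<open>i\<close>-th primitive relation
  at the rays \<open>\<rho>\<^sub>k\<^sup>-\<close> is unitriangular, whereas an element of \<open>N\<^sub>1\<close> is determined by its values at these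
  rays, because the \<open>e\<^sub>k\<^sup>+\<close> are linearly independent. The carrier cone, its uniqueness and the
  integrality of the coefficients come from inverting a triangular, piecewise linear map of
  \<open>\<real>\<^sup>r\<close> that carries the orthants onto the maximal cones.
\<close>

section \<open>Simplicial cones\<close>

text \<open>The nonnegative combinations form a convex cone containing \<open>B\<close>, and closure
  under sums and scaling puts them into every other such cone. This gives the coordinates for all
  arguments about cones below.\<close>

lemma convex_cone_hull_finite_explicit:
  fixes B :: "'a::real_vector set"
  assumes "finite B"
  shows "convex_cone hull B = {\<Sum>v\<in>B. c v *\<^sub>R v | c. \<forall>v\<in>B. 0 \<le> c v}"
    (is "_ = ?C")
proof (rule hull_unique)
  show "B \<subseteq> ?C"
  proof
    fix w assume "w \<in> B"
    then have "w = (\<Sum>v\<in>B. (if v = w then 1 else 0) *\<^sub>R v)"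
      using assms by (simp add: if_distrib [of "\<lambda>c. c *\<^sub>R _"] cong: if_cong)
    then show "w \<in> ?C" by force
  qed
  show "convex_cone ?C"
    unfolding convex_cone_iff
  proof (intro conjI ballI allI impI)
    show "0 \<in> ?C" by (auto intro!: exI [of _ "\<lambda>_. 0"])
  next
    fix x y assume "x \<in> ?C" "y \<in> ?C"
    then obtain c d where "x = (\<Sum>v\<in>B. c v *\<^sub>R v)" "y = (\<Sum>v\<in>B. d v *\<^sub>R v)"
      "\<forall>v\<in>B. 0 \<le> c v" "\<forall>v\<in>B. 0 \<le> d v" by blast
    then show "x + y \<in> ?C"
      by (auto intro!: exI [of _ "\<lambda>v. c v + d v"] simp: scaleR_left_distrib sum.distrib)
  next
    fix x and t :: real assume "x \<in> ?C" "0 \<le> t"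
    then obtain c where "x = (\<Sum>v\<in>B. c v *\<^sub>R v)" "\<forall>v\<in>B. 0 \<le> c v" by blast
    then show "t *\<^sub>R x \<in> ?C"
      using \<open>0 \<le> t\<close> by (auto intro!: exI [of _ "\<lambda>v. t * c v"] simp: scaleR_sum_right)
  qed
  fix T assume T: "B \<subseteq> T" "convex_cone T"
  show "?C \<subseteq> T"
  proof clarify
    fix c :: "'a \<Rightarrow> real" assume c: "\<forall>v\<in>B. 0 \<le> c v"
    have "(\<Sum>v\<in>A. c v *\<^sub>R v) \<in> T" if "A \<subseteq> B" for A
      using finite_subset [OF that assms] that
    proof (induction A rule: finite_induct)
      case empty
      then show ?case using T convex_cone_contains_0 by auto
    next
      case (insert w A)
      then show ?case using T c by (auto intro!: convex_cone_add convex_cone_scaleR)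
    qed
    then show "(\<Sum>v\<in>B. c v *\<^sub>R v) \<in> T" by blast
  qed
qed

lemma independent_sum_eq_iff:
  fixes B :: "'a::real_vector set"
  assumes "finite B" "independent B"
  shows "(\<Sum>v\<in>B. c v *\<^sub>R v) = (\<Sum>v\<in>B. d v *\<^sub>R v) \<longleftrightarrow> (\<forall>v\<in>B. c v = d v)"
proof
  assume "(\<Sum>v\<in>B. c v *\<^sub>R v) = (\<Sum>v\<in>B. d v *\<^sub>R v)"
  then have "(\<Sum>v\<in>B. (c v - d v) *\<^sub>R v) = 0"
    by (simp add: scaleR_left_diff_distrib sum_subtractf)
  from independentD [OF assms(2,1) subset_refl this] show "\<forall>v\<in>B. c v = d v" by simp
qed simp

text \<open>Coordinates with respect to \<open>B\<close> are unique by independence. If a proper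
  mixture of two nonnegative coordinates is zero, both are zero, so the endpoints have no component
  outside \<open>T\<close> when \<open>x\<close> has none.\<close>

lemma face_of_convex_cone_hull_subset:
  fixes B :: "'a::real_vector set"
  assumes "finite B" "independent B" "T \<subseteq> B"
  shows "convex_cone hull T face_of convex_cone hull B"
  unfolding face_of_def
proof (intro conjI ballI impI)
  show "convex_cone hull T \<subseteq> convex_cone hull B" using assms(3) by (rule hull_mono)
  show "convex (convex_cone hull T)" by (rule convex_convex_cone_hull)
  fix a b x
  assume a: "a \<in> convex_cone hull B" and b: "b \<in> convex_cone hull B"
    and x: "x \<in> convex_cone hull T" and ab: "x \<in> open_segment a b"
  have finT: "finite T" using assms finite_subset by blast
  obtain c where c: "a = (\<Sum>v\<in>B. c v *\<^sub>R v)" "\<forall>v\<in>B. 0 \<le> c v"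
    using a assms(1) by (auto simp: convex_cone_hull_finite_explicit)
  obtain d where d: "b = (\<Sum>v\<in>B. d v *\<^sub>R v)" "\<forall>v\<in>B. 0 \<le> d v"
    using b assms(1) by (auto simp: convex_cone_hull_finite_explicit)
  obtain e where e: "x = (\<Sum>v\<in>T. e v *\<^sub>R v)"
    using x finT by (auto simp: convex_cone_hull_finite_explicit)
  have e': "x = (\<Sum>v\<in>B. (if v \<in> T then e v else 0) *\<^sub>R v)"
    unfolding e using assms by (intro sum.mono_neutral_cong_left) auto
  obtain u where u: "0 < u" "u < 1" "x = (1 - u) *\<^sub>R a + u *\<^sub>R b"
    using ab by (auto simp: in_segment)
  have "x = (\<Sum>v\<in>B. ((1 - u) * c v + u * d v) *\<^sub>R v)"
    by (simp add: u(3) c d scaleR_sum_right sum.distrib scaleR_left_distrib)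
  from trans [OF e' [symmetric] this]
  have eq: "\<forall>v\<in>B. (if v \<in> T then e v else 0) = (1 - u) * c v + u * d v"
    by (simp only: independent_sum_eq_iff [OF assms(1,2)])
  have z: "c v = 0 \<and> d v = 0" if "v \<in> B - T" for v
  proof -
    have "(1 - u) * c v + u * d v = 0" using eq that by auto
    moreover have "(1 - u) * c v \<ge> 0" "u * d v \<ge> 0" using u c d that by auto
    ultimately show ?thesis using u by (simp add: add_nonneg_eq_0_iff)
  qed
  have "a = (\<Sum>v\<in>T. c v *\<^sub>R v)" "b = (\<Sum>v\<in>T. d v *\<^sub>R v)"
    unfolding c(1) d(1) using assms z by (simp_all add: sum.mono_neutral_right)
  then show "a \<in> convex_cone hull T" "b \<in> convex_cone hull T"
    using c d assms(3) finT by (auto simp: convex_cone_hull_finite_explicit)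
qed

text \<open>The subset is \<open>B \<inter> F\<close>: a face that contains a nonnegative
  combination also contains every generator occurring in it with a nonzero coefficient.\<close>

lemma face_of_convex_cone_hull_imp:
  fixes B :: "'a::real_vector set"
  assumes "finite B" "F face_of convex_cone hull B" "F \<noteq> {}"
  obtains T where "T \<subseteq> B" "F = convex_cone hull T"
proof
  let ?C = "convex_cone hull B"
  have con: "conic F" using face_of_conic [OF conic_convex_cone_hull assms(2)] .
  have cc: "convex_cone F"
    using con assms face_of_imp_convex by (auto simp: convex_cone_def)
  show "B \<inter> F \<subseteq> B" by simp
  have "F \<subseteq> convex_cone hull (B \<inter> F)"
  proof
    fix x assume x: "x \<in> F"
    then have "x \<in> ?C" using assms(2) face_of_imp_subset by blast
    then obtain c where c: "x = (\<Sum>v\<in>B. c v *\<^sub>R v)" "\<forall>v\<in>B. 0 \<le> c v"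
      using assms(1) by (auto simp: convex_cone_hull_finite_explicit)
    have inF: "w \<in> F" if w: "w \<in> B" "c w \<noteq> 0" for w
    proof -
      \<comment> \<open>The point \<open>x\<close> is the midpoint of \<open>a\<close> and
        \<open>b\<close>, which both lie in the cone, so the face property yields
        \<open>a \<in> F\<close>, and rescaling yields \<open>w \<in> F\<close>.\<close>
      define a where "a = (2 * c w) *\<^sub>R w"
      define b where "b = 2 *\<^sub>R (\<Sum>v\<in>B-{w}. c v *\<^sub>R v)"
      have "a \<in> ?C" unfolding a_def using w c
        by (intro convex_cone_hull_mul) (auto simp: hull_inc)
      moreover have "(\<Sum>v\<in>B-{w}. c v *\<^sub>R v) \<in> convex_cone hull (B - {w})"
        using assms(1) c by (auto simp: convex_cone_hull_finite_explicit)
      then have "b \<in> ?C"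
        unfolding b_def using hull_mono [of "B - {w}" B convex_cone]
        by (intro convex_cone_hull_mul) auto
      moreover have xm: "x = (1/2) *\<^sub>R a + (1/2) *\<^sub>R b"
        using assms(1) w by (simp add: a_def b_def c sum.remove)
      ultimately have "a \<in> F"
      \<comment> \<open>If \<open>a = b\<close>, the open segment is empty and the face property
        gives nothing, but then \<open>x = a\<close> already.\<close>
      proof (cases "a = b")
        case True
        then show ?thesis using xm x by (simp flip: scaleR_left_distrib)
      next
        case False
        then have "x \<in> open_segment a b"
          using xm by (auto simp: in_segment intro!: exI [of _ "1/2"])
        then show ?thesis
          using assms(2) x \<open>a \<in> ?C\<close> \<open>b \<in> ?C\<close> by (auto simp: face_of_def)
      qed
      then have "(1 / (2 * c w)) *\<^sub>R a \<in> F"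
        using con c w by (auto simp: conic_def)
      then show ?thesis using w by (simp add: a_def)
    qed
    have "x = (\<Sum>v\<in>B \<inter> F. c v *\<^sub>R v)"
      unfolding c using assms(1) inF by (intro sum.mono_neutral_right) auto
    then show "x \<in> convex_cone hull (B \<inter> F)"
      using assms(1) c by (auto simp: convex_cone_hull_finite_explicit)
  qed
  moreover have "convex_cone hull (B \<inter> F) \<subseteq> F"
    using cc by (intro hull_minimal) auto
  ultimately show "F = convex_cone hull (B \<inter> F)" by blast
qed

text \<open>Uses the prolongation criterion: \<open>z\<close> is in the relative interior iff every
  segment from a point of the cone to \<open>z\<close> can be extended beyond \<open>z\<close>
  inside the cone.\<close>

lemma rel_interior_convex_cone_hull_independent:
  fixes B :: "'a::euclidean_space set"
  assumes "finite B" "independent B"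
  shows "rel_interior (convex_cone hull B) = {\<Sum>v\<in>B. c v *\<^sub>R v | c. \<forall>v\<in>B. 0 < c v}"
    (is "rel_interior ?C = ?R")
proof -
  have iff: "z \<in> rel_interior ?C \<longleftrightarrow> (\<forall>x\<in>?C. \<exists>e>1. (1 - e) *\<^sub>R x + e *\<^sub>R z \<in> ?C)" for z
    by (rule convex_rel_interior_iff [OF convex_convex_cone_hull convex_cone_hull_nonempty])
  have C: "?C = {\<Sum>v\<in>B. c v *\<^sub>R v | c. \<forall>v\<in>B. 0 \<le> c v}"
    by (rule convex_cone_hull_finite_explicit [OF assms(1)])
  show ?thesis
  proof (intro equalityI subsetI)
    fix z assume z: "z \<in> rel_interior ?C"
    then obtain c where c: "z = (\<Sum>v\<in>B. c v *\<^sub>R v)"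
      using rel_interior_subset C by blast
    \<comment> \<open>Prolonging from the point with all coordinates 1 gives
      \<open>(1 - e) + e * c v \<ge> 0\<close> with \<open>e > 1\<close>, which forces
      \<open>c v > 0\<close>.\<close>
    have "(\<Sum>v\<in>B. 1 *\<^sub>R v) \<in> ?C" unfolding C by (auto intro!: exI [of _ "\<lambda>_. 1"])
    then obtain e where e: "e > 1" "(1 - e) *\<^sub>R (\<Sum>v\<in>B. 1 *\<^sub>R v) + e *\<^sub>R z \<in> ?C"
      using z iff by blast
    then obtain d where d: "(1 - e) *\<^sub>R (\<Sum>v\<in>B. 1 *\<^sub>R v) + e *\<^sub>R z = (\<Sum>v\<in>B. d v *\<^sub>R v)"
      "\<forall>v\<in>B. 0 \<le> d v" unfolding C by blast
    have "(\<Sum>v\<in>B. ((1 - e) + e * c v) *\<^sub>R v) = (\<Sum>v\<in>B. d v *\<^sub>R v)"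
      unfolding d(1) [symmetric] c by (simp add: scaleR_sum_right sum.distrib scaleR_left_distrib)
    then have eq: "\<forall>v\<in>B. (1 - e) + e * c v = d v"
      using independent_sum_eq_iff [OF assms] by metis
    have "0 < c v" if "v \<in> B" for v
    proof -
      have "e * c v > 0" using eq d(2) e(1) that by fastforce
      then show ?thesis using e(1) by (simp add: zero_less_mult_iff)
    qed
    then show "z \<in> ?R" using c by blast
  next
    fix z assume "z \<in> ?R"
    then obtain c where c: "z = (\<Sum>v\<in>B. c v *\<^sub>R v)" "\<forall>v\<in>B. 0 < c v" by blast
    show "z \<in> rel_interior ?C"
      unfolding iff
    proof
      fix x assume "x \<in> ?C"
      then obtain d where d: "x = (\<Sum>v\<in>B. d v *\<^sub>R v)" "\<forall>v\<in>B. 0 \<le> d v" unfolding C by blast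
      \<comment> \<open>As \<open>m\<close> bounds every ratio \<open>d v / c v\<close>, prolonging
        by \<open>1 / (m + 1)\<close> keeps all coordinates nonnegative; the summand 1 keeps the
        denominator positive.\<close>
      define m where "m = (\<Sum>v\<in>B. d v / c v)"
      have m: "d v \<le> m * c v" if "v \<in> B" for v
      proof -
        have "d v / c v \<le> m" unfolding m_def
          using that c d assms(1) by (intro member_le_sum) (auto simp: less_imp_le)
        then show ?thesis using c that by (simp add: pos_divide_le_eq)
      qed
      have "m \<ge> 0" unfolding m_def using c d by (intro sum_nonneg) (auto simp: less_imp_le)
      define e where "e = 1 + 1 / (m + 1)"
      have e: "e > 1" using \<open>m \<ge> 0\<close> by (simp add: e_def)
      have "0 \<le> (1 - e) * d v + e * c v" if "v \<in> B" for v
      proof -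
        have "d v \<le> (m + 1) * c v" using m [OF that] c that by (auto simp: algebra_simps add_increasing2 less_imp_le)
        then have "d v / (m + 1) \<le> c v" using \<open>m \<ge> 0\<close> by (simp add: pos_divide_le_eq mult.commute)
        moreover have "c v \<le> e * c v" using c e that by simp
        moreover have "(1 - e) * d v = - (d v / (m + 1))" by (simp add: e_def)
        ultimately show ?thesis by simp
      qed
      moreover have "(1 - e) *\<^sub>R x + e *\<^sub>R z = (\<Sum>v\<in>B. ((1 - e) * d v + e * c v) *\<^sub>R v)"
        by (simp add: c d scaleR_sum_right sum.distrib scaleR_left_distrib)
      ultimately show "\<exists>e>1. (1 - e) *\<^sub>R x + e *\<^sub>R z \<in> ?C"
        unfolding C using e by (auto intro!: exI [of _ e] exI [of _ "\<lambda>v. (1 - e) * d v + e * c v"])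
    qed
  qed
qed

lemma dim_convex_cone_hull_independent:
  fixes B :: "'a::euclidean_space set"
  assumes "independent B"
  shows "dim (convex_cone hull B) = card B"
proof (rule dim_unique [OF hull_subset _ assms refl])
  show "convex_cone hull B \<subseteq> span B"
    by (intro hull_minimal span_superset convex_cone_span)
qed

text \<open>Strong induction on the number of smaller elements, for solving triangular systems one
  coordinate at a time.\<close>

lemma finite_linorder_less_induct [case_names less]:
  fixes a :: "'a::{finite,linorder}"
  assumes "\<And>x. (\<And>y. y < x \<Longrightarrow> P y) \<Longrightarrow> P x"
  shows "P a"
proof (induction a rule: measure_induct_rule [where f = "\<lambda>x. card {..<x}"])
  case (less x)
  have "card {..<y} < card {..<x}" if "y < x" for y
    using that by (intro psubset_card_mono) auto
  then show ?case using less assms(1) by blast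
qed

text \<open>Passes from coefficients attached to generators to coefficients attached to indices;
  \<open>P\<close> will be nonnegativity for cones and positivity for their relative
  interiors.\<close>

lemma image_Collect_sum_scaleR:
  assumes "inj_on g T"
  shows "{\<Sum>v\<in>g ` T. c v *\<^sub>R v | c. \<forall>v\<in>g ` T. P (c v)} =
         {\<Sum>k\<in>T. c k *\<^sub>R g k | c. \<forall>k\<in>T. P (c k)}" (is "?L = ?R")
proof (intro equalityI subsetI)
  fix x assume "x \<in> ?L"
  then obtain c where "x = (\<Sum>v\<in>g ` T. c v *\<^sub>R v)" "\<forall>v\<in>g ` T. P (c v)" by blast
  then show "x \<in> ?R"
    using assms by (auto simp: sum.reindex intro!: exI [of _ "c \<circ> g"])
next
  fix x assume "x \<in> ?R"
  then obtain c where "x = (\<Sum>k\<in>T. c k *\<^sub>R g k)" "\<forall>k\<in>T. P (c k)" by blast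
  then show "x \<in> ?L"
    using assms by (auto simp: sum.reindex intro!: exI [of _ "c \<circ> inv_into T g"])
qed

section \<open>The fan of a Bott tower\<close>

lemma bott_gen_nth:
  "bott_gen \<beta> i s $ j =
    (if i = j then if s then 1 else - 1
     else if i < j \<and> \<not> s then - of_int (\<beta> i j) else 0)"
  by (auto simp: bott_gen_def axis_def if_distrib cong: if_cong)

lemma bott_gen_in_lattice: "bott_gen \<beta> i s \<in> lattice_points"
  by (simp add: lattice_points_def bott_gen_nth)

lemma bott_gen_nonzero: "bott_gen \<beta> i s \<noteq> 0"
proof
  assume "bott_gen \<beta> i s = 0"
  then have "bott_gen \<beta> i s $ i = 0" by simp
  then show False by (simp add: bott_gen_nth split: if_splits)
qed

text \<open>Triangularity: coordinate \<open>j\<close> only sees generators of index at most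
  \<open>j\<close>, the earlier weights vanish by induction, and the diagonal entry is 1 or
  -1.\<close>

lemma bott_gen_sum_eq_0D:
  assumes "(\<Sum>k\<in>UNIV. w k *\<^sub>R bott_gen \<beta> k (\<epsilon> k)) = 0"
  shows "w j = 0"
proof (induction j rule: finite_linorder_less_induct)
  case (less j)
  have "0 = (\<Sum>k\<in>UNIV. w k *\<^sub>R bott_gen \<beta> k (\<epsilon> k)) $ j" using assms by simp
  also have "\<dots> = (\<Sum>k\<in>UNIV. w k * bott_gen \<beta> k (\<epsilon> k) $ j)" by simp
  also have "\<dots> = (\<Sum>k\<in>UNIV. if k = j then w j * (if \<epsilon> j then 1 else - 1) else 0)"
    using less by (intro sum.cong) (auto simp: bott_gen_nth)
  finally show ?case by (simp split: if_splits)
qed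

text \<open>
  The inverse of the piecewise linear coordinates of the fan: on the orthant with sign
  vector \<open>\<epsilon>\<close> this is the linear map onto the maximal cone of \<open>\<epsilon>\<close>.
\<close>

definition bott_pl :: "('n::{finite,linorder} \<Rightarrow> 'n \<Rightarrow> int) \<Rightarrow> ('n \<Rightarrow> real) \<Rightarrow> (real, 'n) vec" where
  "bott_pl \<beta> y = (\<Sum>k\<in>UNIV. \<bar>y k\<bar> *\<^sub>R bott_gen \<beta> k (0 \<le> y k))"

text \<open>Only negative generators have off-diagonal entries, so an earlier \<open>y k\<close>
  enters through its negative part alone. Coordinate \<open>j\<close> is thus \<open>y j\<close>
  plus a function of earlier values, which can be inverted recursively.\<close>

lemma bott_pl_nth: "bott_pl \<beta> y $ j = y j - (\<Sum>k\<in>{..<j}. max 0 (- y k) * of_int (\<beta> k j))"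
proof -
  have "bott_pl \<beta> y $ j = (\<Sum>k\<in>UNIV. \<bar>y k\<bar> * bott_gen \<beta> k (0 \<le> y k) $ j)"
    by (simp add: bott_pl_def)
  also have "\<dots> = (\<Sum>k\<in>UNIV. (if k = j then y j else 0) +
      (if k \<in> {..<j} then - (max 0 (- y k) * of_int (\<beta> k j)) else 0))"
    by (intro sum.cong) (auto simp: bott_gen_nth)
  also have "\<dots> = y j - (\<Sum>k\<in>{..<j}. max 0 (- y k) * of_int (\<beta> k j))"
    by (simp add: sum.distrib sum.If_cases sum_negf lessThan_def)
  finally show ?thesis .
qed

text \<open>Stated for an initial segment, since it serves both for injectivity and for showing that
  the preimage of a vector with vanishing first coordinates vanishes there too.\<close>

lemma bott_pl_eq_upto:
  assumes "\<And>k. k \<le> j \<Longrightarrow> bott_pl \<beta> y $ k = bott_pl \<beta> z $ k"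
  shows "y j = z j"
  using assms
proof (induction j rule: finite_linorder_less_induct)
  case (less j)
  have "bott_pl \<beta> y $ j = bott_pl \<beta> z $ j" using less.prems by simp
  moreover have "(\<Sum>k\<in>{..<j}. max 0 (- y k) * of_int (\<beta> k j)) =
      (\<Sum>k\<in>{..<j}. max 0 (- z k) * real_of_int (\<beta> k j))"
    using less by (intro sum.cong) auto
  ultimately show ?case by (simp add: bott_pl_nth)
qed

lemma inj_bott_pl: "inj (bott_pl \<beta>)"
proof (intro injI ext)
  fix y z :: "'a \<Rightarrow> real" and j
  assume "bott_pl \<beta> y = bott_pl \<beta> z"
  then show "y j = z j" by (intro bott_pl_eq_upto [of j \<beta> y z]) simp
qed

text \<open>The triangular system has diagonal entries 1 and integer data, so forward substitution
  stays in the integers. This makes the coefficients of the primitive relations integral.\<close>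

lemma bott_pl_integral_preimage:
  fixes x :: "'n::{finite,linorder} \<Rightarrow> int"
  shows "\<exists>y. bott_pl \<beta> (\<lambda>k. of_int (y k)) = (\<chi> j. of_int (x j))"
proof -
  \<comment> \<open>The system is solved on growing index sets: a new maximum \<open>b\<close>
    occurs in none of the earlier equations, so only the value at \<open>b\<close> has to be chosen.
    Taking \<open>A = UNIV\<close> gives the full system.\<close>
  have "\<exists>y. \<forall>j\<in>A. y j = x j + (\<Sum>k\<in>A \<inter> {..<j}. max 0 (- y k) * \<beta> k j)" for A :: "'n set"
    using finite [of A]
  proof (induction A rule: finite_linorder_max_induct)
    case (insert b A)
    then obtain y where y: "\<forall>j\<in>A. y j = x j + (\<Sum>k\<in>A \<inter> {..<j}. max 0 (- y k) * \<beta> k j)"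
      by blast
    define z where "z = y(b := x b + (\<Sum>k\<in>A. max 0 (- y k) * \<beta> k b))"
    have nb: "b \<notin> A" and zA: "\<And>k. k \<in> A \<Longrightarrow> z k = y k"
      using insert.hyps by (auto simp: z_def)
    have "z j = x j + (\<Sum>k\<in>insert b A \<inter> {..<j}. max 0 (- z k) * \<beta> k j)" if "j \<in> insert b A" for j
    proof (cases "j = b")
      case True
      have "insert b A \<inter> {..<b} = A" using insert.hyps by auto
      moreover have "(\<Sum>k\<in>A. max 0 (- z k) * \<beta> k b) = (\<Sum>k\<in>A. max 0 (- y k) * \<beta> k b)"
        using zA by (intro sum.cong) auto
      ultimately show ?thesis using True by (simp add: z_def)
    next
      case False
      then have j: "j \<in> A" "insert b A \<inter> {..<j} = A \<inter> {..<j}"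
        using insert.hyps that by (auto simp: not_less less_imp_le)
      have "(\<Sum>k\<in>A \<inter> {..<j}. max 0 (- z k) * \<beta> k j) = (\<Sum>k\<in>A \<inter> {..<j}. max 0 (- y k) * \<beta> k j)"
        using zA by (intro sum.cong) auto
      then show ?thesis using bspec [OF y j(1)] zA [OF j(1)] j(2) by simp
    qed
    then show ?case by blast
  qed simp
  from this [of UNIV] obtain y where
    y: "\<And>j. y j = x j + (\<Sum>k\<in>{..<j}. max 0 (- y k) * \<beta> k j)" by auto
  have eq: "real_of_int (y j) =
      of_int (x j) + (\<Sum>k\<in>{..<j}. max 0 (- real_of_int (y k)) * of_int (\<beta> k j))" for j
    using arg_cong [OF y [of j], of real_of_int]
    by (simp only: of_int_add of_int_sum of_int_mult of_int_max of_int_0 of_int_minus)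
  have "bott_pl \<beta> (\<lambda>k. of_int (y k)) $ j = of_int (x j)" for j
    using eq [of j] unfolding bott_pl_nth by linarith
  then have "bott_pl \<beta> (\<lambda>k. of_int (y k)) = (\<chi> j. of_int (x j))"
    by (simp add: vec_eq_iff)
  then show ?thesis by blast
qed

section \<open>Uniqueness of positive expansions\<close>

lemma bott_pl_signed:
  assumes "\<And>k. k \<in> T \<Longrightarrow> 0 < c k"
  shows "bott_pl \<beta> (\<lambda>k. if k \<in> T then if \<epsilon> k then c k else - c k else 0) =
         (\<Sum>k\<in>T. c k *\<^sub>R bott_gen \<beta> k (\<epsilon> k))"
proof -
  have "0 \<le> c k" "\<not> c k \<le> 0" if "k \<in> T" for k
    using assms [OF that] by auto
  then show ?thesis
    unfolding bott_pl_def by (intro sum.mono_neutral_cong_right) auto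
qed

text \<open>Both sums are values of the injective map \<open>bott_pl\<close> at signed coefficient
  functions. By strict positivity, the support, signs and absolute values of such a function recover
  \<open>T\<close>, \<open>\<epsilon>\<close> and \<open>c\<close>.\<close>

lemma bott_gen_sum_unique:
  assumes eq: "(\<Sum>k\<in>T. c k *\<^sub>R bott_gen \<beta> k (\<epsilon> k)) = (\<Sum>k\<in>T'. c' k *\<^sub>R bott_gen \<beta> k (\<epsilon>' k))"
    and pos: "\<And>k. k \<in> T \<Longrightarrow> 0 < c k" "\<And>k. k \<in> T' \<Longrightarrow> 0 < c' k"
  shows "T = T'" and "\<And>k. k \<in> T \<Longrightarrow> \<epsilon> k = \<epsilon>' k \<and> c k = c' k"
proof -
  have *: "(if k \<in> T then if \<epsilon> k then c k else - c k else 0) =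
        (if k \<in> T' then if \<epsilon>' k then c' k else - c' k else 0)" for k
    using injD [OF inj_bott_pl, of \<beta> "\<lambda>k. if k \<in> T then if \<epsilon> k then c k else - c k else 0"
        "\<lambda>k. if k \<in> T' then if \<epsilon>' k then c' k else - c' k else 0"]
    by (simp add: bott_pl_signed pos eq fun_eq_iff)
  show "T = T'"
  proof (intro equalityI subsetI)
    fix k assume "k \<in> T"
    then show "k \<in> T'" using * [of k] pos(1) [of k] by (auto split: if_splits)
  next
    fix k assume "k \<in> T'"
    then show "k \<in> T" using * [of k] pos(2) [of k] by (auto split: if_splits)
  qed
  then show "\<epsilon> k = \<epsilon>' k \<and> c k = c' k" if "k \<in> T" for k
    using * [of k] pos [of k] that by (auto split: if_splits)
qed

lemma bott_gen_eq_iff [simp]: "bott_gen \<beta> i s = bott_gen \<beta> j t \<longleftrightarrow> i = j \<and> s = t"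
  using bott_gen_sum_unique [where \<beta> = \<beta> and T = "{i}" and c = "\<lambda>_. 1" and \<epsilon> = "\<lambda>_. s"
      and T' = "{j}" and c' = "\<lambda>_. 1" and \<epsilon>' = "\<lambda>_. t"] by auto

lemma inj_on_bott_gen: "inj_on (\<lambda>k. bott_gen \<beta> k (\<epsilon> k)) T"
  by (auto intro: inj_onI)

lemma independent_bott_gens: "independent ((\<lambda>k. bott_gen \<beta> k (\<epsilon> k)) ` T)"
proof (rule independent_mono)
  show "independent (range (\<lambda>k. bott_gen \<beta> k (\<epsilon> k)))"
  proof (rule independent_if_scalars_zero)
    fix f x
    assume "(\<Sum>x\<in>range (\<lambda>k. bott_gen \<beta> k (\<epsilon> k)). f x *\<^sub>R x) = 0"
      and x: "x \<in> range (\<lambda>k. bott_gen \<beta> k (\<epsilon> k))"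
    then have "(\<Sum>k\<in>UNIV. f (bott_gen \<beta> k (\<epsilon> k)) *\<^sub>R bott_gen \<beta> k (\<epsilon> k)) = 0"
      by (simp add: sum.reindex [OF inj_on_bott_gen])
    from bott_gen_sum_eq_0D [OF this] x show "f x = 0" by auto
  qed simp
qed auto

section \<open>The cones of the fan, indexed by signs and sets of generators\<close>

definition bott_cone ::
    "('n::{finite,linorder} \<Rightarrow> 'n \<Rightarrow> int) \<Rightarrow> ('n \<Rightarrow> bool) \<Rightarrow> 'n set \<Rightarrow> (real, 'n) vec set" where
  "bott_cone \<beta> \<epsilon> T = convex_cone hull ((\<lambda>k. bott_gen \<beta> k (\<epsilon> k)) ` T)"

lemma bott_cone_explicit:
  "bott_cone \<beta> \<epsilon> T = {\<Sum>k\<in>T. c k *\<^sub>R bott_gen \<beta> k (\<epsilon> k) | c. \<forall>k\<in>T. 0 \<le> c k}"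
  by (simp only: bott_cone_def convex_cone_hull_finite_explicit finite_imageI finite
      image_Collect_sum_scaleR [OF inj_on_bott_gen, where P = "\<lambda>c. 0 \<le> c"])

lemma rel_interior_bott_cone:
  "rel_interior (bott_cone \<beta> \<epsilon> T) =
    {\<Sum>k\<in>T. c k *\<^sub>R bott_gen \<beta> k (\<epsilon> k) | c. \<forall>k\<in>T. 0 < c k}"
  by (simp only: bott_cone_def
      rel_interior_convex_cone_hull_independent [OF finite_imageI [OF finite] independent_bott_gens]
      image_Collect_sum_scaleR [OF inj_on_bott_gen, where P = "\<lambda>c. 0 < c"])

lemma dim_bott_cone: "dim (bott_cone \<beta> \<epsilon> T) = card T"
  by (simp add: bott_cone_def dim_convex_cone_hull_independent independent_bott_gens
      card_image [OF inj_on_bott_gen])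

lemma bott_cone_face_of: "S \<subseteq> T \<Longrightarrow> bott_cone \<beta> \<epsilon> S face_of bott_cone \<beta> \<epsilon> T"
  unfolding bott_cone_def
  by (intro face_of_convex_cone_hull_subset independent_bott_gens) auto

lemma bott_cone_cong:
  assumes "\<And>k. k \<in> T \<Longrightarrow> \<epsilon> k = \<epsilon>' k"
  shows "bott_cone \<beta> \<epsilon> T = bott_cone \<beta> \<epsilon>' T"
proof -
  have "(\<lambda>k. bott_gen \<beta> k (\<epsilon> k)) ` T = (\<lambda>k. bott_gen \<beta> k (\<epsilon>' k)) ` T"
    using assms by (intro image_cong) auto
  then show ?thesis by (simp add: bott_cone_def)
qed

lemma bott_ray_eq_cone: "bott_ray \<beta> k (\<epsilon> k) = bott_cone \<beta> \<epsilon> {k}"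
  by (simp add: bott_ray_def bott_cone_def)

text \<open>The maximal cones are simplicial, so their nonempty faces are exactly the cones over
  subsets of their generators; \<open>T = {}\<close> gives the zero cone.\<close>

lemma bott_fan_eq: "bott_fan \<beta> = {bott_cone \<beta> \<epsilon> T | \<epsilon> T. True}"
proof (intro equalityI subsetI)
  fix \<tau> assume "\<tau> \<in> bott_fan \<beta>"
  then obtain \<epsilon> where \<tau>: "\<tau> \<noteq> {}"
    "\<tau> face_of convex_cone hull (range (\<lambda>k. bott_gen \<beta> k (\<epsilon> k)))"
    by (auto simp: bott_fan_def bott_max_cone_def)
  then obtain G where "G \<subseteq> range (\<lambda>k. bott_gen \<beta> k (\<epsilon> k))" "\<tau> = convex_cone hull G"
    using face_of_convex_cone_hull_imp [OF _ \<tau>(2,1)] by auto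
  then show "\<tau> \<in> {bott_cone \<beta> \<epsilon> T | \<epsilon> T. True}"
    by (auto simp: bott_cone_def subset_image_iff)
next
  fix \<tau> assume "\<tau> \<in> {bott_cone \<beta> \<epsilon> T | \<epsilon> T. True}"
  then obtain \<epsilon> T where \<tau>: "\<tau> = bott_cone \<beta> \<epsilon> T" by blast
  then have "\<tau> face_of bott_max_cone \<beta> \<epsilon>"
    using bott_cone_face_of [of T UNIV \<beta> \<epsilon>] by (simp add: bott_cone_def bott_max_cone_def)
  then show "\<tau> \<in> bott_fan \<beta>"
    using \<tau> by (auto simp: bott_fan_def bott_cone_def convex_cone_hull_nonempty)
qed

lemma rays_bott_fan: "rays (bott_fan \<beta>) = (\<lambda>(k, s). bott_ray \<beta> k s) ` UNIV"
proof (intro equalityI subsetI)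
  fix \<rho> assume "\<rho> \<in> rays (bott_fan \<beta>)"
  then obtain \<epsilon> k where "\<rho> = bott_cone \<beta> \<epsilon> {k}"
    by (auto simp: rays_def bott_fan_eq dim_bott_cone card_1_singleton_iff)
  then show "\<rho> \<in> (\<lambda>(k, s). bott_ray \<beta> k s) ` UNIV"
    by (auto simp flip: bott_ray_eq_cone)
next
  fix \<rho> assume "\<rho> \<in> (\<lambda>(k, s). bott_ray \<beta> k s) ` UNIV"
  then obtain k s where "\<rho> = bott_cone \<beta> (\<lambda>_. s) {k}"
    by (auto simp: bott_ray_eq_cone [where \<epsilon> = "\<lambda>_. _"])
  then show "\<rho> \<in> rays (bott_fan \<beta>)"
    by (auto simp: rays_def bott_fan_eq dim_bott_cone)
qed

section \<open>Rays and primitive generators\<close>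

lemma bott_ray_lattice_points:
  "bott_ray \<beta> i s \<inter> lattice_points = {real m *\<^sub>R bott_gen \<beta> i s | m. True}"
proof -
  have ray: "bott_ray \<beta> i s = {t *\<^sub>R bott_gen \<beta> i s | t. 0 \<le> t}"
    unfolding bott_ray_eq_cone [where \<epsilon> = "\<lambda>_. s"] bott_cone_explicit
  proof (intro equalityI subsetI)
    fix x assume "x \<in> {t *\<^sub>R bott_gen \<beta> i s | t. 0 \<le> t}"
    then obtain t where "x = t *\<^sub>R bott_gen \<beta> i s" "0 \<le> t" by blast
    then show "x \<in> {\<Sum>k\<in>{i}. c k *\<^sub>R bott_gen \<beta> k s | c. \<forall>k\<in>{i}. 0 \<le> c k}"
      by (intro CollectI exI [of _ "\<lambda>_. t"]) simp
  qed auto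
  have "\<exists>m. t = real m" if "0 \<le> t" "t *\<^sub>R bott_gen \<beta> i s \<in> lattice_points" for t
  proof -
    \<comment> \<open>Coordinate \<open>i\<close> of the generator is 1 or -1, so integrality there
      already forces \<open>t\<close> to be an integer.\<close>
    have "(t *\<^sub>R bott_gen \<beta> i s) $ i \<in> \<int>"
      using that(2) unfolding lattice_points_def by blast
    then have "t \<in> \<int>" by (simp add: bott_gen_nth split: if_splits)
    then obtain z where "t = of_int z" by (elim Ints_cases)
    then show ?thesis using that(1) by (intro exI [of _ "nat z"]) simp
  qed
  moreover have "real m *\<^sub>R bott_gen \<beta> i s \<in> lattice_points" for m
    using bott_gen_in_lattice [of \<beta> i s] by (simp add: lattice_points_def)
  ultimately show ?thesis unfolding ray by fastforce
qed

text \<open>Two generators of the same monoid are natural multiples of each other; as the vector is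
  nonzero, the product of the multipliers is 1.\<close>

lemma prim_gen_bott_ray [simp]: "prim_gen (bott_ray \<beta> i s) = bott_gen \<beta> i s"
  unfolding prim_gen_def bott_ray_lattice_points
proof (rule the_equality)
  fix u
  let ?g = "bott_gen \<beta> i s"
  assume eq: "{real m *\<^sub>R ?g | m. True} = {real m *\<^sub>R u | m :: nat. True}"
  have "real 1 *\<^sub>R ?g \<in> {real m *\<^sub>R u | m. True}" unfolding eq [symmetric] by blast
  then obtain m where m: "?g = real m *\<^sub>R u" by auto
  have "real 1 *\<^sub>R u \<in> {real m *\<^sub>R ?g | m. True}" unfolding eq by blast
  then obtain n where n: "u = real n *\<^sub>R ?g" by auto
  have "?g = (real m * real n) *\<^sub>R ?g" using m n by (metis scaleR_scaleR)
  then have "(real m * real n - 1) *\<^sub>R ?g = 0" by (simp add: scaleR_left_diff_distrib)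
  then have "real (m * n) = 1" using bott_gen_nonzero [of \<beta> i s] by simp
  then have "m * n = 1" by linarith
  then show "u = ?g" using m by simp
qed rule

lemma bott_ray_eq_iff [simp]: "bott_ray \<beta> i s = bott_ray \<beta> j t \<longleftrightarrow> i = j \<and> s = t"
proof
  assume "bott_ray \<beta> i s = bott_ray \<beta> j t"
  then have "prim_gen (bott_ray \<beta> i s) = prim_gen (bott_ray \<beta> j t)" by (simp only:)
  then show "i = j \<and> s = t" by simp
qed simp

lemma bott_gen_mem_bott_cone_iff: "bott_gen \<beta> k s \<in> bott_cone \<beta> \<epsilon> T \<longleftrightarrow> k \<in> T \<and> s = \<epsilon> k"
proof
  assume "bott_gen \<beta> k s \<in> bott_cone \<beta> \<epsilon> T"
  then obtain c where c: "bott_gen \<beta> k s = (\<Sum>j\<in>T. c j *\<^sub>R bott_gen \<beta> j (\<epsilon> j))"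
      "\<forall>j\<in>T. 0 \<le> c j" by (auto simp: bott_cone_explicit)
  \<comment> \<open>Zero coefficients are dropped because uniqueness of expansions requires strictly
    positive ones.\<close>
  have "(\<Sum>j\<in>T. c j *\<^sub>R bott_gen \<beta> j (\<epsilon> j)) =
      (\<Sum>j\<in>{j\<in>T. c j \<noteq> 0}. c j *\<^sub>R bott_gen \<beta> j (\<epsilon> j))"
    by (intro sum.mono_neutral_right) auto
  with c have "(\<Sum>j\<in>{k}. 1 *\<^sub>R bott_gen \<beta> j s) =
      (\<Sum>j\<in>{j\<in>T. c j \<noteq> 0}. c j *\<^sub>R bott_gen \<beta> j (\<epsilon> j))" by simp
  note unique = bott_gen_sum_unique [OF this]
  have pos: "0 < c j" if "j \<in> {j\<in>T. c j \<noteq> 0}" for j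
    using that c(2) by (auto simp: less_le)
  have "{k} = {j\<in>T. c j \<noteq> 0}" by (rule unique(1)) (use pos in auto)
  moreover have "s = \<epsilon> k \<and> 1 = c k" by (rule unique(2)) (use pos in auto)
  ultimately show "k \<in> T \<and> s = \<epsilon> k" by blast
qed (auto simp: bott_cone_def intro: hull_inc)

text \<open>A ray that is a face has its generator in the cone, and the only fan generators in the
  cone are those indexed by \<open>T\<close> with sign \<open>\<epsilon>\<close>.\<close>

lemma cone_rays_bott_cone:
  "cone_rays (bott_fan \<beta>) (bott_cone \<beta> \<epsilon> T) = (\<lambda>k. bott_ray \<beta> k (\<epsilon> k)) ` T"
proof (intro equalityI subsetI)
  fix \<rho> assume "\<rho> \<in> cone_rays (bott_fan \<beta>) (bott_cone \<beta> \<epsilon> T)"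
  then obtain k s where \<rho>: "\<rho> = bott_ray \<beta> k s" "\<rho> face_of bott_cone \<beta> \<epsilon> T"
    by (auto simp: cone_rays_def rays_bott_fan)
  have "bott_gen \<beta> k s \<in> \<rho>" unfolding \<rho>(1) bott_ray_def by (simp add: hull_inc)
  then have "bott_gen \<beta> k s \<in> bott_cone \<beta> \<epsilon> T" using \<rho>(2) face_of_imp_subset by blast
  then show "\<rho> \<in> (\<lambda>k. bott_ray \<beta> k (\<epsilon> k)) ` T"
    using \<rho>(1) by (simp add: bott_gen_mem_bott_cone_iff)
next
  fix \<rho> assume "\<rho> \<in> (\<lambda>k. bott_ray \<beta> k (\<epsilon> k)) ` T"
  then show "\<rho> \<in> cone_rays (bott_fan \<beta>) (bott_cone \<beta> \<epsilon> T)"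
    by (auto simp: cone_rays_def rays_bott_fan) (simp add: bott_ray_eq_cone bott_cone_face_of)
qed

text \<open>Uniqueness of positive expansions in geometric form; it makes the carrier cone in
  \<open>bott_gamma\<close> well defined.\<close>

lemma bott_cone_rel_interior_disjoint:
  assumes "x \<in> rel_interior (bott_cone \<beta> \<epsilon> T)" "x \<in> rel_interior (bott_cone \<beta> \<epsilon>' T')"
  shows "bott_cone \<beta> \<epsilon> T = bott_cone \<beta> \<epsilon>' T'"
proof -
  obtain c c' where c: "x = (\<Sum>k\<in>T. c k *\<^sub>R bott_gen \<beta> k (\<epsilon> k))" "\<forall>k\<in>T. 0 < c k"
    and c': "x = (\<Sum>k\<in>T'. c' k *\<^sub>R bott_gen \<beta> k (\<epsilon>' k))" "\<forall>k\<in>T'. 0 < c' k"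
    using assms unfolding rel_interior_bott_cone by blast
  have eq: "(\<Sum>k\<in>T. c k *\<^sub>R bott_gen \<beta> k (\<epsilon> k)) = (\<Sum>k\<in>T'. c' k *\<^sub>R bott_gen \<beta> k (\<epsilon>' k))"
    using c(1) c'(1) by simp
  have "T = T'" "\<And>k. k \<in> T \<Longrightarrow> \<epsilon> k = \<epsilon>' k"
    using bott_gen_sum_unique [OF eq] c(2) c'(2) by blast+
  then show ?thesis using bott_cone_cong by blast
qed

section \<open>Primitive relations\<close>

text \<open>The sum has integer coordinates that vanish up to \<open>i\<close>. Its integral
  preimage \<open>y\<close> under \<open>bott_pl\<close> then vanishes up to \<open>i\<close> as
  well; the support of \<open>y\<close> is \<open>T\<close>, its absolute values are
  \<open>c\<close> and its signs are \<open>\<epsilon>\<close>.\<close>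

lemma bott_primitive_sum_expansion:
  obtains \<epsilon> T and c :: "'n::{finite,linorder} \<Rightarrow> int"
  where "T \<subseteq> {i<..}" "\<And>k. k \<in> T \<Longrightarrow> 0 < c k"
    "bott_gen \<beta> i True + bott_gen \<beta> i False = (\<Sum>k\<in>T. of_int (c k) *\<^sub>R bott_gen \<beta> k (\<epsilon> k))"
proof -
  let ?x = "bott_gen \<beta> i True + bott_gen \<beta> i False"
  have x: "?x = (\<chi> j. of_int (if i < j then - \<beta> i j else 0))"
    by (auto simp: vec_eq_iff bott_gen_nth)
  obtain y :: "'n \<Rightarrow> int" where y: "bott_pl \<beta> (\<lambda>k. of_int (y k)) = ?x"
    using bott_pl_integral_preimage [of \<beta> "\<lambda>j. if i < j then - \<beta> i j else 0"] unfolding x by blast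
  have y0: "y j = 0" if "j \<le> i" for j
  proof -
    \<comment> \<open>Comparison with the zero function, whose image is the zero vector.\<close>
    have "bott_pl \<beta> (\<lambda>k. of_int (y k)) $ k = bott_pl \<beta> (\<lambda>_. 0) $ k" if "k \<le> j" for k
      using that \<open>j \<le> i\<close> unfolding y x by (auto simp: bott_pl_nth)
    from bott_pl_eq_upto [OF this] show ?thesis by auto
  qed
  show thesis
  proof
    show "{k. y k \<noteq> 0} \<subseteq> {i<..}" by (auto simp: y0 not_le [symmetric])
    show "0 < \<bar>y k\<bar>" if "k \<in> {k. y k \<noteq> 0}" for k using that by simp
    show "?x = (\<Sum>k\<in>{k. y k \<noteq> 0}. of_int \<bar>y k\<bar> *\<^sub>R bott_gen \<beta> k (0 \<le> y k))"
      unfolding y [symmetric] bott_pl_def by (intro sum.mono_neutral_cong_right) auto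
  qed
qed

lemma bott_gamma_eq:
  assumes "bott_gen \<beta> i True + bott_gen \<beta> i False \<in> rel_interior (bott_cone \<beta> \<epsilon> T)"
  shows "bott_gamma \<beta> i = bott_cone \<beta> \<epsilon> T"
  unfolding bott_gamma_def
proof (rule the_equality)
  show "bott_cone \<beta> \<epsilon> T \<in> bott_fan \<beta> \<and>
      bott_gen \<beta> i True + bott_gen \<beta> i False \<in> rel_interior (bott_cone \<beta> \<epsilon> T)"
    using assms by (auto simp: bott_fan_eq)
  fix \<gamma>
  assume "\<gamma> \<in> bott_fan \<beta> \<and> bott_gen \<beta> i True + bott_gen \<beta> i False \<in> rel_interior \<gamma>"
  moreover from this obtain \<epsilon>' T' where "\<gamma> = bott_cone \<beta> \<epsilon>' T'"
    by (auto simp: bott_fan_eq)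
  ultimately show "\<gamma> = bott_cone \<beta> \<epsilon> T"
    using bott_cone_rel_interior_disjoint [OF _ assms] by blast
qed

text \<open>The coefficients \<open>c\<close>, carried from indices to rays and extended by zero,
  satisfy the defining description; uniqueness of positive expansions excludes any other
  solution.\<close>

lemma bott_coeff_eq:
  assumes gamma: "bott_gamma \<beta> i = bott_cone \<beta> \<epsilon> T"
    and pos: "\<And>k. k \<in> T \<Longrightarrow> 0 < c k"
    and eq: "bott_gen \<beta> i True + bott_gen \<beta> i False =
      (\<Sum>k\<in>T. of_int (c k) *\<^sub>R bott_gen \<beta> k (\<epsilon> k))"
    and "k \<in> T"
  shows "bott_coeff \<beta> i (bott_ray \<beta> k (\<epsilon> k)) = c k"
proof -
  let ?r = "\<lambda>k. bott_ray \<beta> k (\<epsilon> k)"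
  have inj: "inj_on ?r T" by (auto intro: inj_onI)
  let ?Q = "\<lambda>d. (\<forall>\<rho>\<in>?r ` T. d \<rho> > 0) \<and> (\<forall>\<rho>. \<rho> \<notin> ?r ` T \<longrightarrow> d \<rho> = 0) \<and>
    bott_gen \<beta> i True + bott_gen \<beta> i False = (\<Sum>\<rho>\<in>?r ` T. real_of_int (d \<rho>) *\<^sub>R prim_gen \<rho>)"
  define d where "d = (\<lambda>\<rho>. if \<rho> \<in> ?r ` T then c (the_inv_into T ?r \<rho>) else 0)"
  have d: "d (?r k) = c k" if "k \<in> T" for k
    using that by (auto simp: d_def the_inv_into_f_f [OF inj])
  have "(\<Sum>\<rho>\<in>?r ` T. real_of_int (d \<rho>) *\<^sub>R prim_gen \<rho>) =
      (\<Sum>k\<in>T. of_int (c k) *\<^sub>R bott_gen \<beta> k (\<epsilon> k))"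
    by (simp add: sum.reindex [OF inj] d)
  then have "?Q d" using pos eq d by (auto simp: d_def)
  moreover have "d' = d" if d': "?Q d'" for d'
  proof
    fix \<rho>
    have "(\<Sum>k\<in>T. real_of_int (d' (?r k)) *\<^sub>R bott_gen \<beta> k (\<epsilon> k)) =
        (\<Sum>k\<in>T. of_int (c k) *\<^sub>R bott_gen \<beta> k (\<epsilon> k))"
      using d' eq by (simp add: sum.reindex [OF inj])
    from bott_gen_sum_unique(2) [OF this] pos d'
    have "d' (?r k) = c k" if "k \<in> T" for k using that by auto
    then show "d' \<rho> = d \<rho>" using d d' by (cases "\<rho> \<in> ?r ` T") (auto simp: d_def)
  qed
  ultimately have "(THE d. ?Q d) = d" by (rule the_equality)
  then have "bott_coeff \<beta> i = d"
    by (simp add: bott_coeff_def gamma cone_rays_bott_cone Let_def)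
  then show ?thesis using d \<open>k \<in> T\<close> by simp
qed

text \<open>Collects what is needed about a primitive relation: its values on all rays, in terms of
  one expansion supported above \<open>i\<close>, free of the definite descriptions in the
  definitions.\<close>

lemma bott_rel_ray:
  obtains \<epsilon> T and c :: "'n::{finite,linorder} \<Rightarrow> int"
  where "T \<subseteq> {i<..}"
    "bott_gen \<beta> i True + bott_gen \<beta> i False = (\<Sum>k\<in>T. of_int (c k) *\<^sub>R bott_gen \<beta> k (\<epsilon> k))"
    "\<And>k s. bott_rel \<beta> i (bott_ray \<beta> k s) =
      (if k = i then 1 else if k \<in> T \<and> s = \<epsilon> k then - c k else 0)"
    "\<And>\<rho>. \<rho> \<notin> rays (bott_fan \<beta>) \<Longrightarrow> bott_rel \<beta> i \<rho> = 0"
proof -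
  obtain \<epsilon> T and c :: "'n \<Rightarrow> int" where T: "T \<subseteq> {i<..}" and pos: "\<And>k. k \<in> T \<Longrightarrow> 0 < c k"
    and eq: "bott_gen \<beta> i True + bott_gen \<beta> i False =
      (\<Sum>k\<in>T. of_int (c k) *\<^sub>R bott_gen \<beta> k (\<epsilon> k))"
    using bott_primitive_sum_expansion [of i \<beta>] by metis
  have gamma: "bott_gamma \<beta> i = bott_cone \<beta> \<epsilon> T"
    by (rule bott_gamma_eq) (use eq pos in \<open>auto simp: rel_interior_bott_cone\<close>)
  note coeff = bott_coeff_eq [OF gamma pos eq]
  have rel: "bott_rel \<beta> i (bott_ray \<beta> k s) =
      (if k = i then 1 else if k \<in> T \<and> s = \<epsilon> k then - c k else 0)" for k s
    using coeff by (auto simp: bott_rel_def bott_P_def gamma cone_rays_bott_cone)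
  have "bott_rel \<beta> i \<rho> = 0" if "\<rho> \<notin> rays (bott_fan \<beta>)" for \<rho>
    using that by (auto simp: bott_rel_def bott_P_def cone_rays_def rays_bott_fan)
  from that [OF T eq rel this] show thesis by blast
qed

section \<open>Triangularity and the basis property\<close>

lemma bott_rel_diag: "bott_rel \<beta> i (bott_ray \<beta> i s) = 1"
  by (cases s) (simp_all add: bott_rel_def bott_P_def)

lemma bott_rel_lower: "k < i \<Longrightarrow> bott_rel \<beta> i (bott_ray \<beta> k s) = 0"
proof (rule bott_rel_ray [of i \<beta>])
  fix \<epsilon> T and c :: "'a \<Rightarrow> int"
  assume "k < i" "T \<subseteq> {i<..}"
  then have "k \<noteq> i" "k \<notin> T" by auto
  moreover assume rel: "\<And>k s. bott_rel \<beta> i (bott_ray \<beta> k s) =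
      (if k = i then 1 else if k \<in> T \<and> s = \<epsilon> k then - c k else 0)"
  ultimately show "bott_rel \<beta> i (bott_ray \<beta> k s) = 0" by (subst rel) simp
qed

lemma sum_rays_bott_fan:
  "(\<Sum>\<rho>\<in>rays (bott_fan \<beta>). f \<rho>) = (\<Sum>k\<in>UNIV. f (bott_ray \<beta> k True) + f (bott_ray \<beta> k False))"
proof -
  have "inj (\<lambda>(k, s). bott_ray \<beta> k s)" by (auto intro: injI)
  then have "(\<Sum>\<rho>\<in>rays (bott_fan \<beta>). f \<rho>) = (\<Sum>(k, s)\<in>UNIV \<times> UNIV. f (bott_ray \<beta> k s))"
    unfolding rays_bott_fan by (subst sum.reindex) (auto simp: case_prod_unfold)
  also have "\<dots> = (\<Sum>k\<in>UNIV. \<Sum>s\<in>UNIV. f (bott_ray \<beta> k s))"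
    by (rule sum.cartesian_product [symmetric])
  finally show ?thesis by (simp add: UNIV_bool add.commute)
qed

lemma bott_rel_in_N1: "bott_rel \<beta> i \<in> N1 (bott_fan \<beta>)"
proof (rule bott_rel_ray [of i \<beta>])
  fix \<epsilon> T and c :: "'a \<Rightarrow> int"
  assume T: "T \<subseteq> {i<..}"
    and eq: "bott_gen \<beta> i True + bott_gen \<beta> i False =
      (\<Sum>k\<in>T. of_int (c k) *\<^sub>R bott_gen \<beta> k (\<epsilon> k))"
    and rel: "\<And>k s. bott_rel \<beta> i (bott_ray \<beta> k s) =
      (if k = i then 1 else if k \<in> T \<and> s = \<epsilon> k then - c k else 0)"
    and 0: "\<And>\<rho>. \<rho> \<notin> rays (bott_fan \<beta>) \<Longrightarrow> bott_rel \<beta> i \<rho> = 0"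
  \<comment> \<open>Both rays of index \<open>i\<close> contribute, but for \<open>k \<in> T\<close>
    only the ray of sign \<open>\<epsilon> k\<close> does. Since \<open>i \<notin> T\<close>, the
    two kinds of terms never meet and can be split into separate sums.\<close>
  have "(\<Sum>\<rho>\<in>rays (bott_fan \<beta>). of_int (bott_rel \<beta> i \<rho>) *\<^sub>R prim_gen \<rho>) =
      (\<Sum>k\<in>UNIV. (if k = i then bott_gen \<beta> i True + bott_gen \<beta> i False else 0) +
         (if k \<in> T then - (of_int (c k) *\<^sub>R bott_gen \<beta> k (\<epsilon> k)) else 0))"
    unfolding sum_rays_bott_fan using T
    by (intro sum.cong) (auto simp: rel)
  also have "\<dots> = 0"
    by (simp add: sum.distrib sum.If_cases sum_negf eq)
  finally show ?thesis using 0 by (simp add: N1_def)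
qed

text \<open>With zero values on the negative rays, the relation only involves the positive
  generators, which are linearly independent.\<close>

lemma N1_bott_fan_eq_0:
  assumes a: "a \<in> N1 (bott_fan \<beta>)" and neg: "\<And>k. a (bott_ray \<beta> k False) = 0"
  shows "a = 0"
proof
  fix \<rho>
  have "(\<Sum>k\<in>UNIV. of_int (a (bott_ray \<beta> k True)) *\<^sub>R bott_gen \<beta> k True) = 0"
    using a by (simp add: N1_def sum_rays_bott_fan neg)
  from bott_gen_sum_eq_0D [OF this]
  have "a (bott_ray \<beta> k s) = 0" for k s using neg by (cases s) auto
  then show "a \<rho> = 0 \<rho>"
    using a by (cases "\<rho> \<in> rays (bott_fan \<beta>)") (auto simp: N1_def rays_bott_fan)
qed

theorem corollary4p8:
  fixes \<beta> :: "'n::{finite,linorder} \<Rightarrow> 'n \<Rightarrow> int"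
  shows "is_Z_basis {bott_rel \<beta> i | i. True} (N1 (bott_fan \<beta>))"
  unfolding is_Z_basis_def
proof
  let ?B = "{bott_rel \<beta> i | i. True}"
  show "zmod.independent ?B"
  proof
    assume "zmod.dependent ?B"
    then obtain t u v where t: "t \<subseteq> ?B" "finite t" "(\<Sum>v\<in>t. int_scale (u v) v) = 0"
      and v: "v \<in> t" "u v \<noteq> 0"
      by (auto simp: zmod.dependent_explicit)
    \<comment> \<open>Evaluating the dependence at a ray of the least index in \<open>J\<close>
      isolates one coefficient: all other relations with nonzero coefficient have larger index and
      vanish at that ray.\<close>
    define J where "J = {i. bott_rel \<beta> i \<in> t \<and> u (bott_rel \<beta> i) \<noteq> 0}"
    have "J \<noteq> {}" using t(1) v by (auto simp: J_def)
    define i where "i = Min J"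
    have i: "i \<in> J" "\<And>k. k \<in> J \<Longrightarrow> i \<le> k"
      using \<open>J \<noteq> {}\<close> by (auto simp: i_def)
    let ?\<rho> = "bott_ray \<beta> i True"
    have app: "(\<Sum>w\<in>s. int_scale (u w) w) ?\<rho> = (\<Sum>w\<in>s. u w * w ?\<rho>)" for s
      by (induction s rule: infinite_finite_induct) (auto simp: int_scale_def)
    have "u w * w ?\<rho> = 0" if w: "w \<in> t" "w \<noteq> bott_rel \<beta> i" for w
    proof (cases "u w = 0")
      case False
      obtain k where k: "w = bott_rel \<beta> k" using t(1) w by blast
      then have "i < k" using False w i(2) [of k] by (force simp: J_def le_less)
      then show ?thesis using k by (simp add: bott_rel_lower)
    qed simp
    then have "(\<Sum>w\<in>t. u w * w ?\<rho>) = (\<Sum>w\<in>{bott_rel \<beta> i}. u w * w ?\<rho>)"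
      using t(2) i(1) by (intro sum.mono_neutral_right) (auto simp: J_def)
    moreover have "(\<Sum>w\<in>t. u w * w ?\<rho>) = 0"
      using app [of t] unfolding t(3) by simp
    ultimately show False using i(1) by (simp add: bott_rel_diag J_def)
  qed
  have "a \<in> zmod.span ?B" if a: "a \<in> N1 (bott_fan \<beta>)" for a
  proof -
    \<comment> \<open>Elimination in increasing order: adding a multiple of
      \<open>bott_rel \<beta> m\<close> clears the value at the negative ray of \<open>m\<close>,
      where the diagonal entry is 1, and leaves those of smaller index unchanged.\<close>
    have "\<exists>b\<in>zmod.span ?B. \<forall>k\<in>A. (a - b) (bott_ray \<beta> k False) = 0" for A :: "'n set"
      using finite [of A]
    proof (induction A rule: finite_linorder_max_induct)
      case empty
      then show ?case using zmod.span_zero by blast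
    next
      case (insert m A)
      then obtain b where b: "b \<in> zmod.span ?B" "\<And>k. k \<in> A \<Longrightarrow> (a - b) (bott_ray \<beta> k False) = 0"
        by blast
      let ?b = "b + int_scale ((a - b) (bott_ray \<beta> m False)) (bott_rel \<beta> m)"
      have "?b \<in> zmod.span ?B"
        by (intro zmod.span_add [OF b(1)] zmod.span_scale zmod.span_base) blast
      moreover have "(a - ?b) (bott_ray \<beta> k False) = 0" if "k \<in> insert m A" for k
        using that b(2) [of k] insert.hyps(2)
        by (auto simp: int_scale_def bott_rel_diag bott_rel_lower)
      ultimately show ?case by blast
    qed
    from this [of UNIV] obtain b where b: "b \<in> zmod.span ?B"
      and 0: "\<And>k. (a - b) (bott_ray \<beta> k False) = 0" by auto
    have "b \<in> N1 (bott_fan \<beta>)"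
      using b zmod.span_minimal [OF _ subspace_N1, of ?B "bott_fan \<beta>"] bott_rel_in_N1 by blast
    then have "a - b = 0"
      using a 0 by (intro N1_bott_fan_eq_0 zmod.subspace_diff [OF subspace_N1])
    then show ?thesis using b by simp
  qed
  moreover have "zmod.span ?B \<subseteq> N1 (bott_fan \<beta>)"
    using bott_rel_in_N1 by (intro zmod.span_minimal subspace_N1) auto
  ultimately show "zmod.span ?B = N1 (bott_fan \<beta>)" by blast
qed

end
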